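(* Let $c\ge 2$ and $r\ge 1$ be integers, and let $T_{r(c-1)^{r+1},r}$ denote the tree obtained from the star $K_{1,r(c-1)^{r+1}}$ by subdividing each edge $r-1$ times. Then $$M_c\bigl(T_{r(c-1)^{r+1},r}\bigr)\ \ge\ (c-1)r .$$
   Context: The (free) Flood-It game: let $G=(V,E)$ be a connected graph with a colouring $\omega:V\to C$, not necessarily proper, where $C$ is a finite colour-set. A monochromatic component is a maximal set of vertices of one colour inducing a connected subgraph. A move $(v,d)$, with $v\in V$ and $d\in C$, recolours with colour $d$ every vertex in the monochromatic component (with respect to the current colouring) containing $v$. For $d\in C$, $m(G,\omega,d)$ is the minimum number of moves needed, starting from $\omega$, to give all vertices of $G$ colour $d$, and $m(G,\omega)=\min_{d\in C}m(G,\omega,d)$. For a positive integer $c\le |V|$, $M_c(G)=\max_\omega m(G,\omega)$, where the maximum is over all surjective colourings $\omega:V\to\{1,\dots,c\}$ (with colour-set $C=\{1,\dots,c\}$). *)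

theory Defs
  imports "Graph_Theory.Graph_Theory" "HOL-Library.FuncSet"
begin

text \<open>
  Undirected graphs are symmetric digraphs, following the conventions of the graph library.
  There \<^const>\<open>Digraph_Component.connected\<close> requires a nonempty vertex set, so monochromatic
  components are nonempty.
\<close>

definition monochromatic_connected :: "('a, 'b) pre_digraph \<Rightarrow> ('a \<Rightarrow> 'c) \<Rightarrow> 'a set \<Rightarrow> bool" where
  "monochromatic_connected G \<omega> S \<longleftrightarrow>
     S \<subseteq> verts G \<and> (\<forall>u\<in>S. \<forall>v\<in>S. \<omega> u = \<omega> v) \<and> Digraph_Component.connected (G \<restriction> S)"

definition monochromatic_component :: "('a, 'b) pre_digraph \<Rightarrow> ('a \<Rightarrow> 'c) \<Rightarrow> 'a set \<Rightarrow> bool" where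
  "monochromatic_component G \<omega> S \<longleftrightarrow>
     monochromatic_connected G \<omega> S \<and>
     (\<forall>S'. monochromatic_connected G \<omega> S' \<and> S \<subseteq> S' \<longrightarrow> S' = S)"

definition flood_move :: "('a, 'b) pre_digraph \<Rightarrow> ('a \<Rightarrow> 'c) \<Rightarrow> 'a \<times> 'c \<Rightarrow> 'a \<Rightarrow> 'c" where
  "flood_move G \<omega> = (\<lambda>(v, d) u.
     if \<exists>S. monochromatic_component G \<omega> S \<and> v \<in> S \<and> u \<in> S then d else \<omega> u)"

definition floods :: "('a, 'b) pre_digraph \<Rightarrow> 'c set \<Rightarrow> ('a \<Rightarrow> 'c) \<Rightarrow> 'c \<Rightarrow> ('a \<times> 'c) list \<Rightarrow> bool" where
  "floods G C \<omega> d ms \<longleftrightarrow>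
     set ms \<subseteq> verts G \<times> C \<and> (\<forall>u\<in>verts G. foldl (flood_move G) \<omega> ms u = d)"

text \<open>
  For a finite connected graph and \<open>d \<in> C\<close> some sequence of moves floods the graph with \<open>d\<close>,
  so the least number below is attained.
\<close>

definition min_moves_to :: "('a, 'b) pre_digraph \<Rightarrow> 'c set \<Rightarrow> ('a \<Rightarrow> 'c) \<Rightarrow> 'c \<Rightarrow> nat" where
  "min_moves_to G C \<omega> d = (LEAST k. \<exists>ms. length ms = k \<and> floods G C \<omega> d ms)"

definition min_moves :: "('a, 'b) pre_digraph \<Rightarrow> 'c set \<Rightarrow> ('a \<Rightarrow> 'c) \<Rightarrow> nat" where
  "min_moves G C \<omega> = Min (min_moves_to G C \<omega> ` C)"

text \<open>
  Colourings are taken extensional, so that there are only finitely many of them; the values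
  of a colouring outside the vertex set do not influence the number of moves.
\<close>

definition surj_colourings :: "('a, 'b) pre_digraph \<Rightarrow> nat \<Rightarrow> ('a \<Rightarrow> nat) set" where
  "surj_colourings G c = {\<omega> \<in> verts G \<rightarrow>\<^sub>E {1..c}. \<omega> ` verts G = {1..c}}"

definition max_min_moves :: "nat \<Rightarrow> ('a, 'b) pre_digraph \<Rightarrow> nat" where
  "max_min_moves c G = Max (min_moves G {1..c} ` surj_colourings G c)"

definition star :: "nat \<Rightarrow> nat pair_pre_digraph" where
  "star n = \<lparr> pverts = {0..n}, parcs = {0} \<times> {1..n} \<union> {1..n} \<times> {0} \<rparr>"

lemma star_complete_bipartite: "K\<^bsub>1,n\<^esub> (with_proj (star n))"
  unfolding complete_bipartite_digraph_pair_def star_def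
  by (rule conjI, simp, rule exI[of _ "{0}"], rule exI[of _ "{1..n}"]) auto

text \<open>
  \<open>subdivide_edges k G\<close> subdivides every edge of the undirected graph \<open>G\<close> exactly \<open>k\<close> times.
  The linear order on the vertices only serves to orient each edge, so as to number its new
  vertices: an edge \<open>uv\<close> with \<open>u < v\<close> becomes the path \<open>Old u, New u v 1, \<dots>, New u v k, Old v\<close>,
  whose \<open>i\<close>-th vertex is \<open>subdiv_vertex k u v i\<close>.
\<close>

datatype 'a subdiv = Old 'a | New 'a 'a nat

definition subdiv_vertex :: "nat \<Rightarrow> 'a \<Rightarrow> 'a \<Rightarrow> nat \<Rightarrow> 'a subdiv" where
  "subdiv_vertex k u v i = (if i = 0 then Old u else if i = k + 1 then Old v else New u v i)"

definition subdivide_edges :: "nat \<Rightarrow> 'a::linorder pair_pre_digraph \<Rightarrow> 'a subdiv pair_pre_digraph" where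
  "subdivide_edges k G =
     \<lparr> pverts = Old ` pverts G \<union> {New u v i |u v i. (u, v) \<in> parcs G \<and> u < v \<and> i \<in> {1..k}},
       parcs = (\<Union>(u, v) \<in> {(u, v) \<in> parcs G. u < v}. \<Union>i \<in> {0..k}.
         {(subdiv_vertex k u v i, subdiv_vertex k u v (i + 1)),
          (subdiv_vertex k u v (i + 1), subdiv_vertex k u v i)}) \<rparr>"

definition subdivided_star :: "nat \<Rightarrow> nat \<Rightarrow> nat subdiv pair_pre_digraph" where
  "subdivided_star n r = subdivide_edges (r - 1) (star n)"

end

theory Submission
  imports Defs
begin

text \<open>
  Give the centre colour 1 and let every word of length \<open>r\<close> that properly continues it colour
  \<open>r (c - 1)\<close> legs. Fewer than \<open>r (c - 1)\<close> moves leave, for each word, a leg in which no move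
  is made. Such a leg changes only through the component of the centre, so it is flooded only if its
  word is a subsequence of the successive colours of the centre. But a word can be chosen letter by
  letter so that each letter uses up at least \<open>c - 1\<close> of these colours: among the \<open>c - 1\<close>
  admissible letters, one is missing from the next \<open>c - 2\<close> colours.
\<close>

section \<open>Connectedness of induced subgraphs as a cut condition\<close>

text \<open>The set reachable from a vertex is closed under arcs, and a set without outgoing arcs
  traps every walk. With cuts in place of walks, later connectedness arguments only exhibit or
  exclude one crossing arc.\<close>

lemma connected_induce_iff_cut:
  assumes sym: "sym (parcs H)"
  shows "Digraph_Component.connected (with_proj H \<restriction> S) \<longleftrightarrow>
    S \<noteq> {} \<and> (\<forall>A. A \<noteq> {} \<and> A \<subset> S \<longrightarrow> (\<exists>a\<in>A. \<exists>b\<in>S - A. (a, b) \<in> parcs H))"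
proof -
  let ?M = "with_proj (mk_symmetric (with_proj H \<restriction> S))"
  have verts: "verts ?M = S"
    by (simp add: mk_symmetric_def)
  have ends: "arcs_ends ?M = parcs H \<inter> S \<times> S"
    using sym by (auto simp: mk_symmetric_def arcs_ends_def arc_to_ends_def dest: symD)
  show ?thesis
  proof (intro iffI conjI allI impI)
    assume "Digraph_Component.connected (with_proj H \<restriction> S)"
    then have sc: "S \<noteq> {}" "\<And>u v. u \<in> S \<Longrightarrow> v \<in> S \<Longrightarrow> u \<rightarrow>\<^sup>*\<^bsub>?M\<^esub> v"
      using verts unfolding connected_def strongly_connected_def by auto
    show "S \<noteq> {}" by fact
    fix A assume A: "A \<noteq> {} \<and> A \<subset> S"
    then obtain a b where ab: "a \<in> A" "b \<in> S - A" by blast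
    then have "(a, b) \<in> rtrancl_on S (parcs H \<inter> S \<times> S)"
      using sc(2)[of a b] A unfolding reachable_def verts ends by auto
    show "\<exists>a\<in>A. \<exists>b\<in>S - A. (a, b) \<in> parcs H"
    proof (rule ccontr)
      assume no: "\<not> ?thesis"
      from \<open>(a, b) \<in> rtrancl_on S (parcs H \<inter> S \<times> S)\<close> have "b \<in> A"
        by (induction rule: rtrancl_on_induct) (use no ab in auto)
      with ab show False by blast
    qed
  next
    assume cut: "S \<noteq> {} \<and> (\<forall>A. A \<noteq> {} \<and> A \<subset> S \<longrightarrow> (\<exists>a\<in>A. \<exists>b\<in>S - A. (a, b) \<in> parcs H))"
    have "u \<rightarrow>\<^sup>*\<^bsub>?M\<^esub> v" if uv: "u \<in> S" "v \<in> S" for u v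
    proof -
      define A where "A = {x \<in> S. (u, x) \<in> rtrancl_on S (parcs H \<inter> S \<times> S)}"
      have "u \<in> A" using uv by (auto simp: A_def)
      moreover have "(x, y) \<notin> parcs H" if "x \<in> A" "y \<in> S - A" for x y
        using that unfolding A_def by (auto intro: rtrancl_on_into_rtrancl_on)
      moreover have "A \<subseteq> S" by (auto simp: A_def)
      ultimately have "A = S"
        using cut by (metis empty_iff psubsetI)
      with uv show ?thesis unfolding reachable_def verts ends by (auto simp: A_def)
    qed
    then show "Digraph_Component.connected (with_proj H \<restriction> S)"
      using cut verts unfolding connected_def strongly_connected_def by auto
  qed
qed

text \<open>A cut \<open>A\<close> that misses \<open>S\<close> can only be \<open>{t}\<close>, and
  one that contains \<open>S\<close> can only lack \<open>t\<close>; both are crossed by the edge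
  between \<open>s\<close> and \<open>t\<close>. Any other \<open>A\<close> restricts to a cut of
  \<open>S\<close>.\<close>

lemma connected_induce_insert:
  assumes sym: "sym (parcs H)" and conn: "Digraph_Component.connected (with_proj H \<restriction> S)"
    and st: "s \<in> S" "(s, t) \<in> parcs H"
  shows "Digraph_Component.connected (with_proj H \<restriction> insert t S)"
  unfolding connected_induce_iff_cut[OF sym]
proof (intro conjI allI impI)
  fix A assume A: "A \<noteq> {} \<and> A \<subset> insert t S"
  have ts: "(t, s) \<in> parcs H" using sym st by (blast dest: symD)
  consider "A \<inter> S = {}" | "S \<subseteq> A" | "A \<inter> S \<noteq> {}" "A \<inter> S \<subset> S" by blast
  then show "\<exists>a\<in>A. \<exists>b\<in>insert t S - A. (a, b) \<in> parcs H"
  proof cases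
    case 1
    then have "t \<in> A" "s \<in> insert t S - A" using A st by blast+
    with ts show ?thesis by blast
  next
    case 2
    then have "s \<in> A" "t \<in> insert t S - A" using A st by blast+
    with st show ?thesis by blast
  next
    case 3
    then have "\<exists>a\<in>A \<inter> S. \<exists>b\<in>S - A \<inter> S. (a, b) \<in> parcs H"
      using conn[unfolded connected_induce_iff_cut[OF sym], THEN conjunct2, rule_format, of "A \<inter> S"]
      by simp
    then show ?thesis by blast
  qed
qed simp

section \<open>Monochromatic components and existence of flooding sequences\<close>

lemma ex_monochromatic_component_superset:
  assumes fin: "finite (verts G)" and S: "monochromatic_connected G \<omega> S"
  obtains S' where "monochromatic_component G \<omega> S'" "S \<subseteq> S'"
proof -
  let ?F = "{S'. monochromatic_connected G \<omega> S' \<and> S \<subseteq> S'}"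
  have "?F \<subseteq> Pow (verts G)" by (auto simp: monochromatic_connected_def)
  then have "finite ?F" using fin by (simp add: finite_subset)
  then obtain M where "M \<in> ?F" "\<And>X. X \<in> ?F \<Longrightarrow> M \<subseteq> X \<Longrightarrow> M = X"
    using finite_has_maximal2[of ?F S] S by auto
  then have "monochromatic_component G \<omega> M" "S \<subseteq> M"
    by (auto simp: monochromatic_component_def)
  then show thesis by (rule that)
qed

text \<open>Any monochromatic connected set extends to a component, so the effect of a move can be
  read off from such a set without determining the whole component.\<close>

lemma flood_move_on_monochromatic_connected:
  assumes "finite (verts G)" "monochromatic_connected G \<omega> S" "v \<in> S" "u \<in> S"
  shows "flood_move G \<omega> (v, d) u = d"
proof -
  obtain S' where "monochromatic_component G \<omega> S'" "S \<subseteq> S'"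
    using ex_monochromatic_component_superset[OF assms(1,2)] .
  then have "\<exists>S. monochromatic_component G \<omega> S \<and> v \<in> S \<and> u \<in> S"
    using assms(3,4) by blast
  then show ?thesis by (simp add: flood_move_def)
qed

lemma flood_move_cases: "flood_move G \<omega> (v, d) u = d \<or> flood_move G \<omega> (v, d) u = \<omega> u"
  by (simp add: flood_move_def)

text \<open>A monochromatic connected set with an edge from \<open>s\<close> to an outside vertex
  \<open>t\<close> grows by \<open>t\<close> when a move at \<open>s\<close> plays the colour of
  \<open>t\<close>. The last conjunct keeps that colour inside the palette, so that the next move is
  legal.\<close>

lemma ex_moves_monochromatic_connected_card:
  assumes fin: "finite (pverts H)" and sym: "sym (parcs H)"
    and conn: "Digraph_Component.connected (with_proj H \<restriction> pverts H)"
    and \<omega>: "\<omega> ` pverts H \<subseteq> C" and k: "1 \<le> k" "k \<le> card (pverts H)"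
  shows "\<exists>ms S. set ms \<subseteq> pverts H \<times> C \<and>
    monochromatic_connected (with_proj H) (foldl (flood_move (with_proj H)) \<omega> ms) S \<and> card S = k \<and>
    foldl (flood_move (with_proj H)) \<omega> ms ` pverts H \<subseteq> C"
  using k
proof (induction k rule: nat_induct_at_least)
  case base
  obtain v where "v \<in> pverts H"
    using conn unfolding connected_induce_iff_cut[OF sym] by blast
  then have "monochromatic_connected (with_proj H) \<omega> {v}"
    unfolding monochromatic_connected_def connected_induce_iff_cut[OF sym] by auto
  with \<omega> show ?case
    by (intro exI[of _ "[]"] exI[of _ "{v}"]) auto
next
  case (Suc k)
  then obtain ms S where ms: "set ms \<subseteq> pverts H \<times> C"
    and S: "monochromatic_connected (with_proj H) (foldl (flood_move (with_proj H)) \<omega> ms) S" "card S = k"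
    and C: "foldl (flood_move (with_proj H)) \<omega> ms ` pverts H \<subseteq> C"
    by auto
  define \<omega>1 where "\<omega>1 = foldl (flood_move (with_proj H)) \<omega> ms"
  note S = S[folded \<omega>1_def] and C = C[folded \<omega>1_def]
  have SV: "S \<subseteq> pverts H" and Sconn: "Digraph_Component.connected (with_proj H \<restriction> S)"
    using S by (auto simp: monochromatic_connected_def)
  have "S \<noteq> pverts H" "S \<noteq> {}" using S Suc.prems Suc.hyps by auto
  then obtain s t where st: "s \<in> S" "t \<in> pverts H - S" "(s, t) \<in> parcs H"
    using conn SV unfolding connected_induce_iff_cut[OF sym] by blast
  define \<omega>2 where "\<omega>2 = flood_move (with_proj H) \<omega>1 (s, \<omega>1 t)"
  \<comment> \<open>Recoloured or not, \<open>t\<close> ends with \<open>\<omega>1 t\<close>, so it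
    does not matter whether the component of \<open>s\<close> reaches \<open>t\<close>.\<close>
  have "\<omega>2 u = \<omega>1 t" if "u \<in> insert t S" for u
    using that flood_move_on_monochromatic_connected[of "with_proj H" \<omega>1 S s u] fin S st
      flood_move_cases[of "with_proj H" \<omega>1 s "\<omega>1 t" t]
    unfolding \<omega>2_def by auto
  then have "monochromatic_connected (with_proj H) \<omega>2 (insert t S)"
    using connected_induce_insert[OF sym Sconn st(1,3)] st SV
    unfolding monochromatic_connected_def by auto
  moreover have "card (insert t S) = Suc k"
    using S st SV fin by (simp add: finite_subset)
  moreover have "\<omega>2 ` pverts H \<subseteq> C"
  proof
    fix x assume "x \<in> \<omega>2 ` pverts H"
    then obtain u where "u \<in> pverts H" "x = \<omega>2 u" by blast
    then show "x \<in> C"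
      using flood_move_cases[of "with_proj H" \<omega>1 s "\<omega>1 t" u] C st unfolding \<omega>2_def by auto
  qed
  ultimately show ?case
    using ms st SV C
    by (intro exI[of _ "ms @ [(s, \<omega>1 t)]"] exI[of _ "insert t S"]) (auto simp: \<omega>1_def \<omega>2_def)
qed

text \<open>Once one monochromatic set fills the graph, a single further move plays
  \<open>d\<close>. This existence is what gives \<open>min_moves_to\<close>, a
  \<open>LEAST\<close>, its meaning: its value is then the length of an actual flooding
  sequence.\<close>

lemma ex_floods:
  assumes fin: "finite (pverts H)" and sym: "sym (parcs H)"
    and conn: "Digraph_Component.connected (with_proj H \<restriction> pverts H)"
    and \<omega>: "\<omega> ` pverts H \<subseteq> C" and d: "d \<in> C"
  shows "\<exists>ms. floods (with_proj H) C \<omega> d ms"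
proof -
  obtain v where v: "v \<in> pverts H"
    using conn unfolding connected_induce_iff_cut[OF sym] by blast
  then have "1 \<le> card (pverts H)" using fin by (simp add: Suc_le_eq card_gt_0_iff) blast
  then obtain ms S where ms: "set ms \<subseteq> pverts H \<times> C"
    and S: "monochromatic_connected (with_proj H) (foldl (flood_move (with_proj H)) \<omega> ms) S"
    and "card S = card (pverts H)"
    using ex_moves_monochromatic_connected_card[OF fin sym conn \<omega>, of "card (pverts H)"] by blast
  moreover have "S \<subseteq> pverts H" using S by (simp add: monochromatic_connected_def)
  ultimately have "S = pverts H" using fin by (simp add: card_subset_eq)
  then have "floods (with_proj H) C \<omega> d (ms @ [(v, d)])"
    using flood_move_on_monochromatic_connected[of "with_proj H" _ S v _ d] S fin v ms d
    unfolding floods_def by auto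
  then show ?thesis ..
qed

section \<open>Positions, edges and connectedness of the subdivided star\<close>

text \<open>For \<open>r \<ge> 1\<close> the index \<open>i\<close> is the distance from the centre:
  index 0 is the centre for every \<open>j\<close>, and index \<open>r\<close> is the leaf
  \<open>Old j\<close>.\<close>

abbreviation leg_vertex :: "nat \<Rightarrow> nat \<Rightarrow> nat \<Rightarrow> nat subdiv" where
  "leg_vertex r j i \<equiv> subdiv_vertex (r - 1) 0 j i"

text \<open>Legs are numbered from 1, so the value 0 at the centre \<open>Old 0\<close> stands for
  no leg.\<close>

fun leg_of :: "nat subdiv \<Rightarrow> nat" where
  "leg_of (Old j) = j"
| "leg_of (New _ j _) = j"

lemma subdiv_vertex_0 [simp]: "subdiv_vertex k u v 0 = Old u"
  by (simp add: subdiv_vertex_def)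

lemma leg_of_subdiv_vertex: "1 \<le> i \<Longrightarrow> leg_of (subdiv_vertex k u j i) = j"
  by (simp add: subdiv_vertex_def)

text \<open>Different legs share only the centre; the bounds \<open>1 \<le> j\<close> and
  \<open>1 \<le> j'\<close> keep the leaves apart from \<open>Old 0\<close>.\<close>

lemma leg_vertex_eq_iff:
  assumes "1 \<le> j" "1 \<le> j'" "1 \<le> r" "i \<le> r" "i' \<le> r"
  shows "leg_vertex r j i = leg_vertex r j' i' \<longleftrightarrow> i = i' \<and> (i = 0 \<or> j = j')"
  using assms by (auto simp: subdiv_vertex_def)

lemma pverts_subdivided_star:
  assumes "1 \<le> r"
  shows "pverts (subdivided_star n r) = insert (Old 0) {leg_vertex r j i |j i. j \<in> {1..n} \<and> i \<in> {1..r}}"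
    (is "_ = ?R")
proof
  show "pverts (subdivided_star n r) \<subseteq> ?R"
  proof
    fix x assume "x \<in> pverts (subdivided_star n r)"
    then consider j where "x = Old j" "j \<in> {0..n}"
      | j i where "x = New 0 j i" "j \<in> {1..n}" "i \<in> {1..r - 1}"
      unfolding subdivided_star_def subdivide_edges_def star_def by auto
    then show "x \<in> ?R"
    proof cases
      case 1
      show ?thesis
      proof (cases "j = 0")
        case False
        then have "x = leg_vertex r j r" "j \<in> {1..n}" "r \<in> {1..r}"
          using 1 assms by (simp_all add: subdiv_vertex_def)
        then show ?thesis by blast
      qed (simp add: 1)
    next
      case 2
      then have "x = leg_vertex r j i" "i \<in> {1..r}" by (auto simp: subdiv_vertex_def)
      then show ?thesis using 2(2) by blast
    qed
  qed
  have "leg_vertex r j i \<in> pverts (subdivided_star n r)" if "j \<in> {1..n}" "i \<in> {1..r}" for j i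
    using that by (auto simp: subdivided_star_def subdivide_edges_def star_def subdiv_vertex_def)
  moreover have "Old 0 \<in> pverts (subdivided_star n r)"
    by (simp add: subdivided_star_def subdivide_edges_def star_def)
  ultimately show "?R \<subseteq> pverts (subdivided_star n r)"
    by blast
qed

lemma leg_vertex_in_pverts:
  assumes "1 \<le> r" "j \<in> {1..n}" "i \<le> r"
  shows "leg_vertex r j i \<in> pverts (subdivided_star n r)"
proof (cases "i = 0")
  case False
  then have "i \<in> {1..r}" using assms(3) by simp
  then show ?thesis unfolding pverts_subdivided_star[OF assms(1)] using assms(2) by blast
qed (simp add: pverts_subdivided_star[OF assms(1)])

lemma parcs_subdivided_star:
  assumes "1 \<le> r"
  shows "parcs (subdivided_star n r) = (\<Union>j\<in>{1..n}. \<Union>i\<in>{..<r}.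
    {(leg_vertex r j i, leg_vertex r j (Suc i)), (leg_vertex r j (Suc i), leg_vertex r j i)})"
proof -
  have "{(u, v) \<in> parcs (star n). u < v} = {0} \<times> {1..n}"
    by (auto simp: star_def)
  moreover have "{0..r - 1} = {..<r}" using assms by auto
  ultimately show ?thesis
    unfolding subdivided_star_def subdivide_edges_def by auto
qed

lemma finite_pverts_subdivided_star: "1 \<le> r \<Longrightarrow> finite (pverts (subdivided_star n r))"
  unfolding pverts_subdivided_star finite_insert
  by (rule finite_image_set2) simp_all

lemma sym_parcs_subdivided_star: "1 \<le> r \<Longrightarrow> sym (parcs (subdivided_star n r))"
  unfolding parcs_subdivided_star sym_def by blast

text \<open>Some vertex lies across the cut from the centre. Walking out along its leg, the first
  position across the cut ends a crossing edge.\<close>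

lemma connected_subdivided_star:
  assumes "1 \<le> r"
  shows "Digraph_Component.connected (with_proj (subdivided_star n r) \<restriction> pverts (subdivided_star n r))"
  unfolding connected_induce_iff_cut[OF sym_parcs_subdivided_star[OF assms]]
proof (intro conjI allI impI)
  let ?V = "pverts (subdivided_star n r)" and ?E = "parcs (subdivided_star n r)"
  show "?V \<noteq> {}" using assms by (simp add: pverts_subdivided_star)
  fix A assume A: "A \<noteq> {} \<and> A \<subset> ?V"
  obtain x where x: "x \<in> ?V" "x \<in> A \<longleftrightarrow> Old 0 \<notin> A"
    using A by blast
  then obtain j i where ji: "j \<in> {1..n}" "i \<le> r" "x = leg_vertex r j i"
    using assms by (auto simp: pverts_subdivided_star)
  \<comment> \<open>The first position of the leg across the cut from the centre; it is not 0, since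
    position 0 is the centre.\<close>
  define k where "k = (LEAST k. leg_vertex r j k \<in> A \<longleftrightarrow> Old 0 \<notin> A)"
  have k: "leg_vertex r j k \<in> A \<longleftrightarrow> Old 0 \<notin> A" "k \<le> i"
    using x ji LeastI[of "\<lambda>k. leg_vertex r j k \<in> A \<longleftrightarrow> Old 0 \<notin> A" i]
      Least_le[of "\<lambda>k. leg_vertex r j k \<in> A \<longleftrightarrow> Old 0 \<notin> A" i]
    unfolding k_def by auto
  then obtain l where l: "k = Suc l" by (cases k) auto
  then have "\<not> (leg_vertex r j l \<in> A \<longleftrightarrow> Old 0 \<notin> A)"
    using not_less_Least[of l "\<lambda>k. leg_vertex r j k \<in> A \<longleftrightarrow> Old 0 \<notin> A"] by (simp add: k_def)
  moreover have "l < r" using k(2) ji(2) l by simp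
  then have "(leg_vertex r j l, leg_vertex r j k) \<in> ?E" "(leg_vertex r j k, leg_vertex r j l) \<in> ?E"
    unfolding parcs_subdivided_star[OF assms] l using ji(1) by blast+
  moreover have "leg_vertex r j l \<in> ?V" "leg_vertex r j k \<in> ?V"
    using leg_vertex_in_pverts[OF assms ji(1)] k(2) ji(2) l by auto
  ultimately show "\<exists>a\<in>A. \<exists>b\<in>?V - A. (a, b) \<in> ?E"
    using k(1) by (cases "Old 0 \<in> A") blast+
qed

text \<open>The way from a vertex off the leg to position \<open>i\<close> passes through the centre
  and all positions before \<open>i\<close>. If position \<open>k\<close> were missing, the part of
  \<open>S\<close> beyond it would be cut off from \<open>v\<close>.\<close>

lemma connected_meeting_leg_contains_initial_segment:
  assumes r: "1 \<le> r" and j: "j \<in> {1..n}" and i: "i \<le> r"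
    and conn: "Digraph_Component.connected (with_proj (subdivided_star n r) \<restriction> S)"
    and v: "v \<in> S" "v \<notin> leg_vertex r j ` {1..r}" and iS: "leg_vertex r j i \<in> S"
    and k: "k \<le> i"
  shows "leg_vertex r j k \<in> S"
proof (rule ccontr)
  assume no: "leg_vertex r j k \<notin> S"
  define A where "A = S \<inter> leg_vertex r j ` {Suc k..r}"
  have "k < i" using no iS k by (metis le_neq_implies_less)
  then have "A \<noteq> {}" using iS i by (auto simp: A_def)
  moreover have "v \<notin> A" using v by (auto simp: A_def)
  ultimately obtain a b where ab: "a \<in> A" "b \<in> S - A" "(a, b) \<in> parcs (subdivided_star n r)"
    using conn v unfolding connected_induce_iff_cut[OF sym_parcs_subdivided_star[OF r]]
    by (metis A_def Int_lower1 psubsetI)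
  obtain i' where i': "Suc k \<le> i'" "i' \<le> r" "a = leg_vertex r j i'"
    using ab by (auto simp: A_def)
  obtain j' l where jl: "j' \<in> {1..n}" "l < r"
      "a = leg_vertex r j' l \<and> b = leg_vertex r j' (Suc l) \<or>
       a = leg_vertex r j' (Suc l) \<and> b = leg_vertex r j' l"
    using ab(3) unfolding parcs_subdivided_star[OF r] by auto
  from jl(3) show False
  proof
    assume *: "a = leg_vertex r j' l \<and> b = leg_vertex r j' (Suc l)"
    then have "i' = l" "j' = j"
      using i' leg_vertex_eq_iff[of j j' r i' l] j r jl by auto
    then have "b \<in> leg_vertex r j ` {Suc k..r}" using * i'(1) jl(2) by simp
    then show False using ab(2) by (simp add: A_def)
  next
    assume *: "a = leg_vertex r j' (Suc l) \<and> b = leg_vertex r j' l"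
    then have "i' = Suc l" "j' = j"
      using i' leg_vertex_eq_iff[of j j' r i' "Suc l"] j r jl by auto
    \<comment> \<open>An edge leads inward out of \<open>A\<close> only to position
      \<open>k\<close>, which is not in \<open>S\<close>, whereas \<open>b\<close> is.\<close>
    moreover have "l \<noteq> k" using * ab(2) no \<open>j' = j\<close> by blast
    ultimately have "b \<in> leg_vertex r j ` {Suc k..r}" using * i'(1) jl(2) by simp
    then show False using ab(2) by (simp add: A_def)
  qed
qed

section \<open>Legs without moves and the colours of the centre\<close>

text \<open>The effect of the centre taking colour \<open>a\<close> on the unflooded outer part of a
  leg. Dropping one letter is enough: neighbouring letters differ, so the rest does not begin with
  \<open>a\<close> again.\<close>

definition absorb :: "'c list \<Rightarrow> 'c \<Rightarrow> 'c list" where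
  "absorb w a = (case w of [] \<Rightarrow> [] | x # xs \<Rightarrow> if x = a then xs else w)"

text \<open>
  The outermost \<open>length w\<close> vertices of leg \<open>j\<close> carry the word \<open>w\<close>, which does not yet
  start with the colour of the centre; the other vertices of the leg are unconstrained.
\<close>

definition leg_remainder :: "nat \<Rightarrow> nat \<Rightarrow> (nat subdiv \<Rightarrow> 'c) \<Rightarrow> 'c list \<Rightarrow> bool" where
  "leg_remainder r j \<omega> w \<longleftrightarrow> length w \<le> r \<and>
     (\<forall>i<length w. \<omega> (leg_vertex r j (Suc (r - length w + i))) = w ! i) \<and>
     successively (\<noteq>) (\<omega> (Old 0) # w)"

text \<open>A component through \<open>v\<close> that met the remainder would contain both the
  centre and the innermost remainder vertex, but these differ in colour. Hence the remainder keeps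
  its colours, and only the new centre colour can shorten it.\<close>

lemma leg_remainder_flood_move:
  assumes r: "1 \<le> r" and j: "j \<in> {1..n}" and rem: "leg_remainder r j \<omega> w"
    and v: "v \<notin> leg_vertex r j ` {1..r}"
    and \<omega>': "\<omega>' = flood_move (with_proj (subdivided_star n r)) \<omega> (v, d)"
  shows "leg_remainder r j \<omega>' (absorb w (\<omega>' (Old 0)))"
proof (cases w)
  case Nil
  then show ?thesis by (simp add: leg_remainder_def absorb_def)
next
  case (Cons x xs)
  have unchanged: "\<omega>' (leg_vertex r j i) = \<omega> (leg_vertex r j i)" if i: "r - length w < i" "i \<le> r" for i
  proof -
    \<comment> \<open>The position of the first letter of \<open>w\<close>, at or before position
      \<open>i\<close>.\<close>
    let ?p = "Suc (r - length w)"
    have "\<not> (\<exists>S. monochromatic_component (with_proj (subdivided_star n r)) \<omega> S \<and>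
        v \<in> S \<and> leg_vertex r j i \<in> S)"
    proof
      assume "\<exists>S. monochromatic_component (with_proj (subdivided_star n r)) \<omega> S \<and>
        v \<in> S \<and> leg_vertex r j i \<in> S"
      then obtain S where S: "monochromatic_connected (with_proj (subdivided_star n r)) \<omega> S"
        "v \<in> S" "leg_vertex r j i \<in> S"
        by (auto simp: monochromatic_component_def)
      then have conn: "Digraph_Component.connected (with_proj (subdivided_star n r) \<restriction> S)"
        by (simp add: monochromatic_connected_def)
      have "leg_vertex r j 0 \<in> S" "leg_vertex r j ?p \<in> S"
        using connected_meeting_leg_contains_initial_segment[OF r j i(2) conn S(2) v S(3)] i
        by (blast, simp)
      then have "\<omega> (leg_vertex r j 0) = \<omega> (leg_vertex r j ?p)"
        using S(1) unfolding monochromatic_connected_def by blast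
      moreover have "\<omega> (leg_vertex r j ?p) = x" "\<omega> (Old 0) \<noteq> x"
        using rem Cons by (auto simp: leg_remainder_def)
      ultimately show False by simp
    qed
    then show ?thesis unfolding \<omega>' flood_move_def prod.case by (rule if_not_P)
  qed
  have len: "length w \<le> r" using rem by (simp add: leg_remainder_def)
  have w: "\<omega>' (leg_vertex r j (Suc (r - length w + i))) = w ! i" if "i < length w" for i
    using unchanged[of "Suc (r - length w + i)"] that len rem by (simp add: leg_remainder_def)
  have succ: "successively (\<noteq>) w"
    using rem Cons by (simp add: leg_remainder_def)
  show ?thesis
  proof (cases "x = \<omega>' (Old 0)")
    case True
    have "\<omega>' (leg_vertex r j (Suc (r - length xs + i))) = xs ! i" if "i < length xs" for i
    proof -
      \<comment> \<open>One letter less moves the start of the remainder one position outward; the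
        subtraction is exact because \<open>length w \<le> r\<close>.\<close>
      have "r - length xs + i = r - length w + Suc i" using len Cons by simp
      then show ?thesis using w[of "Suc i"] that Cons by simp
    qed
    then show ?thesis using True Cons len succ by (simp add: leg_remainder_def absorb_def)
  next
    case False
    then show ?thesis using Cons len succ w by (auto simp: leg_remainder_def absorb_def)
  qed
qed

text \<open>One entry per move, also when the centre keeps its colour, so the length counts moves.
  The initial colour is left out, since no leg remainder begins with it.\<close>

primrec centre_colours :: "(nat subdiv, 'b) pre_digraph \<Rightarrow> (nat subdiv \<Rightarrow> 'c) \<Rightarrow>
    (nat subdiv \<times> 'c) list \<Rightarrow> 'c list" where
  "centre_colours G \<omega> [] = []"
| "centre_colours G \<omega> (m # ms) =
     flood_move G \<omega> m (Old 0) # centre_colours G (flood_move G \<omega> m) ms"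

lemma length_centre_colours [simp]: "length (centre_colours G \<omega> ms) = length ms"
  by (induction ms arbitrary: \<omega>) auto

text \<open>The list of centre colours is the same for all legs without moves. Folding
  \<open>absorb\<close> over it is greedy subsequence matching: it yields \<open>[]\<close> exactly
  if the word is a subsequence of the list.\<close>

lemma leg_remainder_foldl_flood_move:
  assumes "1 \<le> r" "j \<in> {1..n}" "leg_remainder r j \<omega> w"
    and "\<And>v d. (v, d) \<in> set ms \<Longrightarrow> v \<notin> leg_vertex r j ` {1..r}"
  shows "leg_remainder r j (foldl (flood_move (with_proj (subdivided_star n r))) \<omega> ms)
    (foldl absorb w (centre_colours (with_proj (subdivided_star n r)) \<omega> ms))"
  using assms(3,4)
proof (induction ms arbitrary: \<omega> w)
  case (Cons m ms)
  obtain v d where m: "m = (v, d)" by (cases m)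
  then have "v \<notin> leg_vertex r j ` {1..r}" using Cons.prems(2) by auto
  from leg_remainder_flood_move[OF assms(1,2) Cons.prems(1) this refl, of d]
  have "leg_remainder r j (foldl (flood_move (with_proj (subdivided_star n r)))
      (flood_move (with_proj (subdivided_star n r)) \<omega> m) ms)
    (foldl absorb (absorb w (flood_move (with_proj (subdivided_star n r)) \<omega> m (Old 0)))
      (centre_colours (with_proj (subdivided_star n r)) (flood_move (with_proj (subdivided_star n r)) \<omega> m) ms))"
    using Cons.prems(2) unfolding m by (intro Cons.IH) (auto simp del: One_nat_def)
  then show ?case by simp
qed simp

section \<open>Counting words and choosing one that is not absorbed\<close>

definition proper_words :: "'c set \<Rightarrow> nat \<Rightarrow> 'c \<Rightarrow> 'c list set" where
  "proper_words C r a = {w. length w = r \<and> set w \<subseteq> C \<and> successively (\<noteq>) (a # w)}"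

lemma proper_words_Suc:
  "proper_words C (Suc r) a = (\<lambda>(x, w). x # w) ` (SIGMA x:C - {a}. proper_words C r x)"
proof (intro set_eqI iffI)
  fix w assume "w \<in> proper_words C (Suc r) a"
  then obtain x v where "w = x # v" "x \<in> C - {a}" "v \<in> proper_words C r x"
    by (cases w) (auto simp: proper_words_def)
  then show "w \<in> (\<lambda>(x, w). x # w) ` (SIGMA x:C - {a}. proper_words C r x)" by force
qed (auto simp: proper_words_def)

text \<open>Each letter avoids only its predecessor, which leaves \<open>card C - 1\<close> choices
  whatever that predecessor is.\<close>

lemma card_proper_words:
  assumes "finite C" "a \<in> C"
  shows "finite (proper_words C r a) \<and> card (proper_words C r a) = (card C - 1) ^ r"
  using assms(2)
proof (induction r arbitrary: a)
  case 0
  have "proper_words C 0 a = {[]}" by (auto simp: proper_words_def)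
  then show ?case by simp
next
  case (Suc r)
  have fin: "\<forall>x\<in>C - {a}. finite (proper_words C r x)" using Suc.IH by blast
  have "inj_on (\<lambda>(x, w). x # w) (SIGMA x:C - {a}. proper_words C r x)" by (auto simp: inj_on_def)
  then have "card (proper_words C (Suc r) a) = card (SIGMA x:C - {a}. proper_words C r x)"
    unfolding proper_words_Suc by (rule card_image)
  also have "\<dots> = (\<Sum>x\<in>C - {a}. card (proper_words C r x))"
    using assms(1) fin by (simp add: card_SigmaI)
  also have "\<dots> = (\<Sum>x\<in>C - {a}. (card C - 1) ^ r)"
    using Suc.IH by (intro sum.cong) auto
  also have "\<dots> = (card C - 1) ^ Suc r"
    using assms(1) Suc.prems by (simp add: card_Diff_singleton)
  finally have "card (proper_words C (Suc r) a) = (card C - 1) ^ Suc r" .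
  moreover have "finite (proper_words C (Suc r) a)"
    unfolding proper_words_Suc using assms(1) fin by auto
  ultimately show ?case by blast
qed

lemma foldl_absorb_Nil [simp]: "foldl absorb [] D = []"
  by (induction D) (auto simp: absorb_def)

text \<open>Entries before the first \<open>x\<close> are idle, that \<open>x\<close> is used up,
  and \<open>w\<close> is matched against what follows.\<close>

lemma foldl_absorb_Cons:
  "foldl absorb (x # w) D =
    (if x \<in> set D then foldl absorb w (tl (dropWhile (\<lambda>y. y \<noteq> x) D)) else x # w)"
proof (induction D)
  case (Cons d D)
  have "absorb (x # w) d = (if x = d then w else x # w)" by (simp add: absorb_def)
  with Cons show ?case by auto
qed simp

text \<open>The induction varies \<open>a\<close> and \<open>D\<close>: the chosen letter becomes
  the next \<open>a\<close>, and \<open>D\<close> loses everything up to the first occurrence of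
  that letter. For \<open>r = 0\<close> the length bound is contradictory.\<close>

lemma ex_proper_word_not_absorbed:
  assumes "finite C" "card C \<ge> 2" "a \<in> C" "length D < r * (card C - 1)"
  shows "\<exists>w\<in>proper_words C r a. foldl absorb w D \<noteq> []"
  using assms(3,4)
proof (induction r arbitrary: a D)
  case (Suc r)
  \<comment> \<open>A colour other than \<open>a\<close> that the first \<open>card C - 2\<close> entries of \<open>D\<close> miss costs at
    least \<open>card C - 1\<close> entries.\<close>
  let ?T = "set (take (card C - 2) D)"
  have "card ?T \<le> card C - 2" using card_length[of "take (card C - 2) D"] by simp
  moreover have "card (C - {a}) = card C - 1" using assms Suc.prems by simp
  ultimately have "\<not> C - {a} \<subseteq> ?T"
    using card_mono[of ?T "C - {a}"] assms(2) by auto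
  then obtain x where x: "x \<in> C" "x \<noteq> a" "x \<notin> ?T" by blast
  define D' where "D' = tl (dropWhile (\<lambda>y. y \<noteq> x) D)"
  have ext: "x # w \<in> proper_words C (Suc r) a" if "w \<in> proper_words C r x" for w
    using that x by (auto simp: proper_words_Suc)
  show ?case
  proof (cases "x \<in> set D")
    \<comment> \<open>Matching is stuck at \<open>x\<close> for good, so any proper continuation
      will do.\<close>
    case False
    have "card (proper_words C r x) \<noteq> 0"
      using card_proper_words[OF assms(1) x(1), of r] assms(2) by simp
    then obtain w where "w \<in> proper_words C r x" by (metis card.empty equals0I)
    then show ?thesis using ext[of w] False by (intro bexI[of _ "x # w"]) (auto simp: foldl_absorb_Cons)
  next
    case True
    \<comment> \<open>The first \<open>x\<close> has this length as its index, and a smaller index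
      would put \<open>x\<close> into \<open>?T\<close>. Counting \<open>x\<close> itself, at least
      \<open>card C - 1\<close> entries are spent.\<close>
    have "length (takeWhile (\<lambda>y. y \<noteq> x) D) \<ge> card C - 2"
    proof (rule ccontr)
      assume "\<not> ?thesis"
      moreover have "length (takeWhile (\<lambda>y. y \<noteq> x) D) < length D"
        using True by (metis (mono_tags, lifting) length_takeWhile_le le_neq_implies_less set_takeWhileD takeWhile_eq_take take_all order_refl)
      moreover from this have "D ! length (takeWhile (\<lambda>y. y \<noteq> x) D) = x"
        using nth_length_takeWhile by fastforce
      ultimately have "x \<in> ?T"
        by (auto simp: in_set_conv_nth intro!: exI[of _ "length (takeWhile (\<lambda>y. y \<noteq> x) D)"])
      with x show False by blast
    qed
    moreover have "length D = length (takeWhile (\<lambda>y. y \<noteq> x) D) + length (dropWhile (\<lambda>y. y \<noteq> x) D)"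
      by (metis length_append takeWhile_dropWhile_id)
    moreover have "dropWhile (\<lambda>y. y \<noteq> x) D \<noteq> []" using True by auto
    then have "length (dropWhile (\<lambda>y. y \<noteq> x) D) = Suc (length D')"
      by (simp add: D'_def)
    ultimately have "length D' < r * (card C - 1)"
      using Suc.prems(2) assms(2) by simp
    then obtain w where "w \<in> proper_words C r x" "foldl absorb w D' \<noteq> []"
      using Suc.IH[OF x(1)] by blast
    then show ?thesis using ext[of w] True by (intro bexI[of _ "x # w"]) (auto simp: foldl_absorb_Cons D'_def)
  qed
qed simp

section \<open>The colouring built from words and the lower bound\<close>

text \<open>The leaf \<open>Old j\<close> is at position \<open>r\<close> and so takes letter
  \<open>r - 1\<close>. The restriction makes the colouring extensional, as
  \<open>surj_colourings\<close> demands.\<close>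

definition word_colouring :: "nat \<Rightarrow> nat \<Rightarrow> 'c \<Rightarrow> (nat \<Rightarrow> 'c list) \<Rightarrow> nat subdiv \<Rightarrow> 'c" where
  "word_colouring n r a W = restrict
     (\<lambda>v. case v of Old j \<Rightarrow> if j = 0 then a else W j ! (r - 1) | New _ j i \<Rightarrow> W j ! (i - 1))
     (pverts (subdivided_star n r))"

lemma word_colouring_centre: "1 \<le> r \<Longrightarrow> word_colouring n r a W (Old 0) = a"
  by (simp add: word_colouring_def pverts_subdivided_star)

lemma word_colouring_leg_vertex:
  assumes "1 \<le> r" "j \<in> {1..n}" "i \<in> {1..r}"
  shows "word_colouring n r a W (leg_vertex r j i) = W j ! (i - 1)"
proof -
  have "leg_vertex r j i \<in> pverts (subdivided_star n r)"
    using leg_vertex_in_pverts assms by simp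
  then show ?thesis using assms by (auto simp: word_colouring_def subdiv_vertex_def)
qed

text \<open>The choices depend on the given moves: first a word that the resulting centre colours do
  not absorb, then a leg that carries this word and contains no move.\<close>

lemma floods_word_colouring_length:
  assumes r: "1 \<le> r" and C: "finite C" "card C \<ge> 2" "a \<in> C"
    and W: "\<And>w. w \<in> proper_words C r a \<Longrightarrow> r * (card C - 1) \<le> card {j \<in> {1..n}. W j = w}"
    and fl: "floods (with_proj (subdivided_star n r)) C (word_colouring n r a W) d ms"
  shows "r * (card C - 1) \<le> length ms"
proof (rule ccontr)
  let ?G = "with_proj (subdivided_star n r)" and ?\<omega> = "word_colouring n r a W"
  assume "\<not> ?thesis"
  then have len: "length ms < r * (card C - 1)" by simp
  then obtain w where w: "w \<in> proper_words C r a" "foldl absorb w (centre_colours ?G ?\<omega> ms) \<noteq> []"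
    using ex_proper_word_not_absorbed[OF C, of "centre_colours ?G ?\<omega> ms" r] by auto
  \<comment> \<open>Each move spoils at most one leg, fewer than the number of legs carrying
    \<open>w\<close>.\<close>
  have "card ((\<lambda>(v, d). leg_of v) ` set ms) \<le> length ms"
    by (meson card_image_le card_length finite_set le_trans)
  then have "\<not> {j \<in> {1..n}. W j = w} \<subseteq> (\<lambda>(v, d). leg_of v) ` set ms"
    using W[OF w(1)] len card_mono[of "(\<lambda>(v, d). leg_of v) ` set ms" "{j \<in> {1..n}. W j = w}"] by auto
  then obtain j where j: "j \<in> {1..n}" "W j = w" "j \<notin> (\<lambda>(v, d). leg_of v) ` set ms" by blast
  have avoid: "v \<notin> leg_vertex r j ` {1..r}" if "(v, d) \<in> set ms" for v d
  proof
    assume "v \<in> leg_vertex r j ` {1..r}"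
    then have "leg_of v = j" by (auto simp: leg_of_subdiv_vertex)
    with that j(3) show False by force
  qed
  have lw: "length w = r" "successively (\<noteq>) (a # w)" using w by (auto simp: proper_words_def)
  then have "leg_remainder r j ?\<omega> w"
    using word_colouring_leg_vertex[OF r j(1), of "Suc _" a W] j(2)
    by (simp add: leg_remainder_def word_colouring_centre[OF r])
  then have "leg_remainder r j (foldl (flood_move ?G) ?\<omega> ms)
      (foldl absorb w (centre_colours ?G ?\<omega> ms))"
    by (rule leg_remainder_foldl_flood_move[OF r j(1)]) (rule avoid)
  then obtain x xs where rem: "leg_remainder r j (foldl (flood_move ?G) ?\<omega> ms) (x # xs)"
    using w(2) by (cases "foldl absorb w (centre_colours ?G ?\<omega> ms)") simp_all
  \<comment> \<open>The innermost vertex of the nonempty remainder still differs from the centre,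
    which contradicts flooding.\<close>
  have "leg_vertex r j (Suc (r - length (x # xs))) \<in> pverts (subdivided_star n r)"
    using r by (intro leg_vertex_in_pverts[OF r j(1)]) simp
  moreover have "Old 0 \<in> pverts (subdivided_star n r)"
    using r by (simp add: pverts_subdivided_star)
  ultimately have "foldl (flood_move ?G) ?\<omega> ms (leg_vertex r j (Suc (r - length (x # xs)))) =
      foldl (flood_move ?G) ?\<omega> ms (Old 0)"
    using fl by (simp add: floods_def)
  moreover have "foldl (flood_move ?G) ?\<omega> ms (leg_vertex r j (Suc (r - length (x # xs)))) = x"
    "foldl (flood_move ?G) ?\<omega> ms (Old 0) \<noteq> x"
    using rem by (auto simp: leg_remainder_def)
  ultimately show False by simp
qed

text \<open>\<open>W\<close> is the second projection of a bijection from \<open>{1..n}\<close> to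
  \<open>{1..m} \<times> X\<close>.\<close>

lemma ex_map_with_large_fibres:
  assumes "finite X" "n = m * card X"
  shows "\<exists>W. W ` {1..n} \<subseteq> X \<and> (\<forall>x\<in>X. m \<le> card {j \<in> {1..n}. W j = x})"
proof -
  have "card ({1..m} \<times> X) = card {1..n}" using assms by (simp add: card_cartesian_product)
  then obtain f where f: "bij_betw f ({1..m} \<times> X) {1..n}"
    using finite_same_card_bij assms(1) by (metis finite_SigmaI finite_atLeastAtMost)
  define g where "g = inv_into ({1..m} \<times> X) f"
  have g: "bij_betw g {1..n} ({1..m} \<times> X)" unfolding g_def using f by (rule bij_betw_inv_into)
  have gf: "g (f p) = p" if "p \<in> {1..m} \<times> X" for p
    unfolding g_def using f that by (simp add: bij_betw_inv_into_left)
  have "m \<le> card {j \<in> {1..n}. snd (g j) = x}" if "x \<in> X" for x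
  proof -
    have "(\<lambda>k. f (k, x)) ` {1..m} \<subseteq> {j \<in> {1..n}. snd (g j) = x}"
      using gf that bij_betwE[OF f] by auto
    moreover have "inj_on (\<lambda>k. f (k, x)) {1..m}"
      using gf that by (intro inj_onI) (metis SigmaI fst_conv)
    ultimately have "card {1..m} \<le> card {j \<in> {1..n}. snd (g j) = x}"
      by (intro card_inj_on_le) auto
    then show ?thesis by simp
  qed
  moreover have "(\<lambda>j. snd (g j)) ` {1..n} \<subseteq> X" using bij_betwE[OF g] by fastforce
  ultimately show ?thesis by blast
qed

text \<open>The centre supplies colour 1. Every other colour is the first letter of some proper
  word, which some leg carries.\<close>

lemma word_colouring_in_surj_colourings:
  assumes r: "1 \<le> r" and c: "2 \<le> c"
    and W: "W ` {1..n} = proper_words {1..c} r 1"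
  shows "word_colouring n r 1 W \<in> surj_colourings (with_proj (subdivided_star n r)) c"
proof -
  let ?V = "pverts (subdivided_star n r)" and ?\<omega> = "word_colouring n r 1 W"
  have "?\<omega> v \<in> {1..c}" if v: "v \<in> ?V" for v
  proof -
    consider "v = Old 0" | j i where "j \<in> {1..n}" "i \<in> {1..r}" "v = leg_vertex r j i"
      using v unfolding pverts_subdivided_star[OF r] by blast
    then show ?thesis
    proof cases
      case 1
      then show ?thesis using r c by (simp add: word_colouring_centre)
    next
      case 2
      then have "W j \<in> proper_words {1..c} r 1" using W by blast
      then have "length (W j) = r" "set (W j) \<subseteq> {1..c}" by (auto simp: proper_words_def)
      moreover from this 2 have "W j ! (i - 1) \<in> set (W j)" by (intro nth_mem) auto
      ultimately show ?thesis
        unfolding 2(3) word_colouring_leg_vertex[OF r 2(1,2)] by blast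
    qed
  qed
  moreover have "x \<in> ?\<omega> ` ?V" if x: "x \<in> {1..c}" for x
  proof (cases "x = 1")
    case True
    then show ?thesis using r
      by (intro image_eqI[of _ _ "Old 0"]) (simp_all add: word_colouring_centre pverts_subdivided_star)
  next
    case False
    obtain s where s: "r = Suc s" using r by (cases r) auto
    have "card (proper_words {1..c} s x) \<noteq> 0"
      using card_proper_words[of "{1..c}" x s] x c by simp
    then obtain w where "w \<in> proper_words {1..c} s x" by (metis card.empty equals0I)
    then have "x # w \<in> proper_words {1..c} r 1" using x False by (auto simp: s proper_words_Suc)
    then obtain j where j: "j \<in> {1..n}" "W j = x # w" using W by (metis imageE)
    then have "?\<omega> (leg_vertex r j 1) = x"
      using word_colouring_leg_vertex[OF r j(1), of 1 1 W] r by simp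
    moreover have "leg_vertex r j 1 \<in> ?V"
      using leg_vertex_in_pverts[OF r j(1)] r by blast
    ultimately show ?thesis by blast
  qed
  ultimately have "?\<omega> ` ?V = {1..c}" by blast
  moreover have "?\<omega> \<in> extensional ?V" by (simp add: word_colouring_def)
  ultimately show ?thesis by (auto simp: surj_colourings_def PiE_def)
qed

lemma min_moves_to_attained:
  assumes "\<exists>ms. floods G C \<omega> d ms"
  obtains ms where "floods G C \<omega> d ms" "length ms = min_moves_to G C \<omega> d"
proof -
  have "\<exists>k ms. length ms = k \<and> floods G C \<omega> d ms" using assms by blast
  from LeastI_ex[OF this] show thesis using that unfolding min_moves_to_def by blast
qed

theorem lemma2p14:
  fixes c r :: nat
  assumes "c \<ge> 2" and "r \<ge> 1"
  shows "max_min_moves c (with_proj (subdivided_star (r * (c - 1) ^ (r + 1)) r)) \<ge> (c - 1) * r"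
proof -
  define n where "n = r * (c - 1) ^ (r + 1)"
  let ?G = "with_proj (subdivided_star n r)" and ?X = "proper_words {1..c} r 1"
  have X: "finite ?X" "card ?X = (c - 1) ^ r"
    using card_proper_words[of "{1..c}" 1 r] assms by auto
  \<comment> \<open>The exponent \<open>r + 1\<close> splits into \<open>(c - 1) ^ r\<close> words
    and a factor \<open>c - 1\<close> in the number of legs per word.\<close>
  have "n = r * (c - 1) * card ?X" unfolding n_def X by simp
  then obtain W where W: "W ` {1..n} \<subseteq> ?X"
    and fib: "\<And>w. w \<in> ?X \<Longrightarrow> r * (c - 1) \<le> card {j \<in> {1..n}. W j = w}"
    using ex_map_with_large_fibres[OF X(1)] by metis
  have "w \<in> W ` {1..n}" if "w \<in> ?X" for w
  proof -
    \<comment> \<open>Fibres are nonempty, so every word occurs on a leg; surjectivity of the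
      colouring rests on this.\<close>
    have "0 < r * (c - 1)" using assms by simp
    then have "card {j \<in> {1..n}. W j = w} \<noteq> 0" using fib[OF that] by linarith
    then have "{j \<in> {1..n}. W j = w} \<noteq> {}" by (metis card.empty)
    then show ?thesis by blast
  qed
  with W have "W ` {1..n} = ?X" by blast
  then have \<omega>: "word_colouring n r 1 W \<in> surj_colourings ?G c" (is "?\<omega> \<in> _")
    using word_colouring_in_surj_colourings assms by blast
  have lower: "(c - 1) * r \<le> min_moves_to ?G {1..c} ?\<omega> d" if d: "d \<in> {1..c}" for d
  proof -
    have "?\<omega> ` pverts (subdivided_star n r) \<subseteq> {1..c}"
      using \<omega> by (simp add: surj_colourings_def)
    then have "\<exists>ms. floods ?G {1..c} ?\<omega> d ms"
      using d by (rule ex_floods[OF finite_pverts_subdivided_star[OF assms(2)]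
        sym_parcs_subdivided_star[OF assms(2)] connected_subdivided_star[OF assms(2)]])
    then obtain ms where "floods ?G {1..c} ?\<omega> d ms" "length ms = min_moves_to ?G {1..c} ?\<omega> d"
      by (rule min_moves_to_attained)
    then show ?thesis
      using floods_word_colouring_length[of r "{1..c}" 1 n W d ms] assms fib by (simp add: mult.commute)
  qed
  have "(c - 1) * r \<le> min_moves ?G {1..c} ?\<omega>"
    unfolding min_moves_def using assms lower by (subst Min_ge_iff) auto
  also have "\<dots> \<le> max_min_moves c ?G"
    unfolding max_min_moves_def
  proof (rule Max_ge)
    \<comment> \<open>Extensionality makes the set of colourings finite, as \<open>Max_ge\<close>
      requires.\<close>
    have "finite (pverts (subdivided_star n r) \<rightarrow>\<^sub>E {1..c})"
      using finite_pverts_subdivided_star assms by (intro finite_PiE) auto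
    then show "finite (min_moves ?G {1..c} ` surj_colourings ?G c)"
      unfolding surj_colourings_def by simp
    show "min_moves ?G {1..c} ?\<omega> \<in> min_moves ?G {1..c} ` surj_colourings ?G c"
      using \<omega> by blast
  qed
  finally show ?thesis unfolding n_def .
qed

end
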